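(* Let $f_1,\dots,f_n:\mathbb{R}^d\to\mathbb{R}$ be differentiable functions such that, for constants $\mu>0$ and $L_1,\dots,L_n>0$, for all $i\in\{1,\dots,n\}$ and all $x,y\in\mathbb{R}^d$, $\frac{\mu}{2}\|x-y\|^2\le D_{f_i}(x,y)\le\frac{L_i}{2}\|x-y\|^2$. Let the probabilities satisfy $0<p\le 1$ and $0<q_i\le 1$ for all $i$, and let the stepsize $\gamma>0$ satisfy $$\gamma\le\min_{i}\left\{\frac{1}{L_i}\,\frac{p^2}{1-q_i(1-p^2)}\right\}.$$ Then the iterates of the GradSkip algorithm satisfy, for all $t\ge 1$, $$\mathbb{E}[\Psi_t]\le(1-\rho)^t\,\Psi_0,\qquad \rho:=\min\{\gamma\mu,\;1-q_{\max}(1-p^2)\}>0,$$ where $q_{\max}=\max_i q_i$ and $$\Psi_t:=\sum_{i=1}^n\|x_{i,t}-x_\star\|^2+\frac{\gamma^2}{p^2}\sum_{i=1}^n\|h_{i,t}-h_{i,\star}\|^2 .$$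
   Context: $D_{g}(x,y):=g(x)-g(y)-\langle\nabla g(y),x-y\rangle$ is the Bregman divergence of a differentiable $g$. The point $x_\star$ is the unique minimizer of $f(x)=\frac1n\sum_{i=1}^n f_i(x)$, and $h_{i,\star}:=\nabla f_i(x_\star)$. GradSkip algorithm. Input: stepsize $\gamma>0$, synchronization probability $p$, probabilities $q_1,\dots,q_n$, initial local iterates $x_{1,0}=\dots=x_{n,0}\in\mathbb{R}^d$, and arbitrary initial shifts $h_{1,0},\dots,h_{n,0}\in\mathbb{R}^d$ (all deterministic). All coins $\theta_t$, $\eta_{i,t}$ ($t\ge0$, $1\le i\le n$) are independent $\{0,1\}$-valued random variables with $\mathrm{Prob}(\theta_t=1)=p$ and $\mathrm{Prob}(\eta_{i,t}=1)=q_i$. For $t=0,1,2,\dots$ and every $i\in\{1,\dots,n\}$: (1) $\hat h_{i,t+1}=\eta_{i,t}h_{i,t}+(1-\eta_{i,t})\nabla f_i(x_{i,t})$; (2) $\hat x_{i,t+1}=x_{i,t}-\gamma(\nabla f_i(x_{i,t})-\hat h_{i,t+1})$; (3) if $\theta_t=1$ then $x_{i,t+1}=\frac1n\sum_{j=1}^n\left(\hat x_{j,t+1}-\frac{\gamma}{p}\hat h_{j,t+1}\right)$, otherwise $x_{i,t+1}=\hat x_{i,t+1}$; (4) $h_{i,t+1}=\hat h_{i,t+1}+\frac{p}{\gamma}(x_{i,t+1}-\hat x_{i,t+1})$. *)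

theory Defs
  imports "HOL-Probability.Probability"
begin

definition grad :: "('a::euclidean_space \<Rightarrow> real) \<Rightarrow> 'a \<Rightarrow> 'a" where
  "grad g x = (THE D. GDERIV g x :> D)"

lemma GDERIV_grad:
  fixes g :: "'a::euclidean_space \<Rightarrow> real"
  assumes "g differentiable (at x)"
  shows "GDERIV g x :> grad g x"
proof -
  obtain g' where g': "(g has_derivative g') (at x)"
    using assms by (auto simp: differentiable_def)
  interpret linear g'
    using g' by (rule has_derivative_linear)
  have "g' = (\<lambda>h. inner h (\<Sum>b\<in>Basis. g' b *\<^sub>R b))"
  proof
    fix h
    have "g' h = g' (\<Sum>b\<in>Basis. inner h b *\<^sub>R b)"
      by (simp add: euclidean_representation)
    also have "\<dots> = inner h (\<Sum>b\<in>Basis. g' b *\<^sub>R b)"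
      by (simp add: sum scale inner_sum_right mult.commute)
    finally show "g' h = inner h (\<Sum>b\<in>Basis. g' b *\<^sub>R b)" .
  qed
  with g' have ex: "GDERIV g x :> (\<Sum>b\<in>Basis. g' b *\<^sub>R b)"
    by (simp add: gderiv_def)
  have uniq: "D = E" if "GDERIV g x :> D" "GDERIV g x :> E" for D E
  proof -
    have "(\<lambda>h. inner h D) = (\<lambda>h. inner h E)"
      using that unfolding gderiv_def by (rule has_derivative_unique)
    then have "\<forall>h. inner h D = inner h E"
      by (rule fun_cong[THEN allI])
    then show "D = E"
      by (metis euclidean_eqI inner_commute)
  qed
  show ?thesis
    unfolding grad_def by (rule theI[where a = "\<Sum>b\<in>Basis. g' b *\<^sub>R b"]) (use ex uniq in auto)
qed

definition bregman :: "('a::euclidean_space \<Rightarrow> real) \<Rightarrow> 'a \<Rightarrow> 'a \<Rightarrow> real" where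
  "bregman g x y = g x - g y - inner (grad g y) (x - y)"

text \<open>
  One iteration. Clients are indexed by \<open>{1..n}\<close>; a state is the pair of the families of iterates
  and of shifts, whose values outside \<open>{1..n}\<close> are irrelevant. The coins are Booleans, with
  \<open>True\<close> for the value 1.
\<close>

definition gradskip_step ::
  "nat \<Rightarrow> (nat \<Rightarrow> 'a::euclidean_space \<Rightarrow> real) \<Rightarrow> real \<Rightarrow> real \<Rightarrow> bool \<Rightarrow> (nat \<Rightarrow> bool)
    \<Rightarrow> (nat \<Rightarrow> 'a) \<times> (nat \<Rightarrow> 'a) \<Rightarrow> (nat \<Rightarrow> 'a) \<times> (nat \<Rightarrow> 'a)" where
  "gradskip_step n f \<gamma> p \<theta> \<eta> s =
    (let x = fst s;
         h = snd s;
         hhat = (\<lambda>i. of_bool (\<eta> i) *\<^sub>R h i + (1 - of_bool (\<eta> i)) *\<^sub>R grad (f i) (x i));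
         xhat = (\<lambda>i. x i - \<gamma> *\<^sub>R (grad (f i) (x i) - hhat i));
         x' = (\<lambda>i. if \<theta>
                   then (1 / real n) *\<^sub>R (\<Sum>j\<in>{1..n}. xhat j - (\<gamma> / p) *\<^sub>R hhat j)
                   else xhat i);
         h' = (\<lambda>i. hhat i + (p / \<gamma>) *\<^sub>R (x' i - xhat i))
     in (x', h'))"

primrec gradskip ::
  "nat \<Rightarrow> (nat \<Rightarrow> 'a::euclidean_space \<Rightarrow> real) \<Rightarrow> real \<Rightarrow> real \<Rightarrow> 'a \<Rightarrow> (nat \<Rightarrow> 'a)
    \<Rightarrow> (nat \<Rightarrow> 'w \<Rightarrow> bool) \<Rightarrow> (nat \<Rightarrow> nat \<Rightarrow> 'w \<Rightarrow> bool) \<Rightarrow> nat \<Rightarrow> 'w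
    \<Rightarrow> (nat \<Rightarrow> 'a) \<times> (nat \<Rightarrow> 'a)" where
  "gradskip n f \<gamma> p x0 h0 \<theta> \<eta> 0 \<omega> = ((\<lambda>i. x0), h0)"
| "gradskip n f \<gamma> p x0 h0 \<theta> \<eta> (Suc t) \<omega> =
    gradskip_step n f \<gamma> p (\<theta> t \<omega>) (\<lambda>i. \<eta> i t \<omega>) (gradskip n f \<gamma> p x0 h0 \<theta> \<eta> t \<omega>)"

text \<open>
  The index type makes joint independence of all the coins \<open>\<theta> t\<close> and \<open>\<eta> i t\<close> expressible
  as independence of a single family.
\<close>

datatype coin_index = Sync nat | Local nat nat

definition gradskip_coins ::
  "'w measure \<Rightarrow> nat \<Rightarrow> real \<Rightarrow> (nat \<Rightarrow> real) \<Rightarrow> (nat \<Rightarrow> 'w \<Rightarrow> bool)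
    \<Rightarrow> (nat \<Rightarrow> nat \<Rightarrow> 'w \<Rightarrow> bool) \<Rightarrow> bool" where
  "gradskip_coins M n p q \<theta> \<eta> \<longleftrightarrow>
    prob_space.indep_vars M (\<lambda>_. count_space UNIV)
      (\<lambda>c. case c of Sync t \<Rightarrow> \<theta> t | Local i t \<Rightarrow> \<eta> i t)
      (range Sync \<union> {Local i t | i t. i \<in> {1..n}}) \<and>
    (\<forall>t. measure M {\<omega> \<in> space M. \<theta> t \<omega>} = p) \<and>
    (\<forall>i\<in>{1..n}. \<forall>t. measure M {\<omega> \<in> space M. \<eta> i t \<omega>} = q i)"

definition lyapunov ::
  "nat \<Rightarrow> (nat \<Rightarrow> 'a::euclidean_space \<Rightarrow> real) \<Rightarrow> real \<Rightarrow> real \<Rightarrow> 'a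
    \<Rightarrow> (nat \<Rightarrow> 'a) \<times> (nat \<Rightarrow> 'a) \<Rightarrow> real" where
  "lyapunov n f \<gamma> p x_star s =
    (\<Sum>i\<in>{1..n}. (norm (fst s i - x_star))\<^sup>2)
    + \<gamma>\<^sup>2 / p\<^sup>2 * (\<Sum>i\<in>{1..n}. (norm (snd s i - grad (f i) x_star))\<^sup>2)"

end

(* Two exact identities reduce one iteration to deterministic gradient steps. Averaging over the
   synchronization coin, the mean-plus-deviation (Pythagoras) identity and the vanishing of the sum
   of the optimal shifts turn the expected Lyapunov function into a sum over the clients of
   |w_i|^2 + gamma^2/p^2 (1 - p^2) |hhat_i - h_i*|^2, where w_i is the difference between gradient
   steps from x_i and from x_star that uses the gradients of f_i alone. Averaging over the local
   coins then splits the second term into a shift part, contracted by q_i (1 - p^2), and a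
   gradient part. The latter and the gradient part of |w_i|^2 add up to at most gamma / L_i times
   |grad f_i(x_i) - grad f_i(x_star)|^2, by the choice of gamma, and this is absorbed
   by cocoercivity, which leaves the factor 1 - gamma mu in front of |x_i - x_star|^2. *)
theory Submission
  imports Defs
begin

section \<open>Bregman divergences and first-order optimality\<close>

lemma bregman_three_point:
  "bregman g z y = bregman g z x + bregman g x y + inner (grad g x - grad g y) (z - x)"
  by (simp add: bregman_def algebra_simps)

lemma bregman_symmetrized:
  "bregman g x y + bregman g y x = inner (grad g x - grad g y) (x - y)"
  by (simp add: bregman_def algebra_simps)

text \<open>Compare the lower bound at the gradient step \<open>z = x - (grad g x - grad g y) / L\<close> with the upper bound.\<close>
lemma bregman_ge_norm_grad_diff:
  assumes "L > 0"
    and "\<And>z. 0 \<le> bregman g z y"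
    and "\<And>z. bregman g z x \<le> L / 2 * (norm (z - x))\<^sup>2"
  shows "(norm (grad g x - grad g y))\<^sup>2 / (2 * L) \<le> bregman g x y"
proof -
  define G where "G = grad g x - grad g y"
  define z where "z = x - (1 / L) *\<^sub>R G"
  have zx: "z - x = - ((1 / L) *\<^sub>R G)"
    by (simp add: z_def)
  have "0 \<le> bregman g z x + bregman g x y + inner G (z - x)"
    using assms(2)[of z] unfolding G_def bregman_three_point[of g z y x] .
  also have "bregman g z x \<le> L / 2 * (norm (z - x))\<^sup>2"
    by (rule assms(3))
  also have "L / 2 * (norm (z - x))\<^sup>2 = (norm G)\<^sup>2 / (2 * L)"
    using \<open>L > 0\<close> unfolding zx by (simp add: power_divide field_simps power2_eq_square)
  also have "inner G (z - x) = - ((norm G)\<^sup>2 / L)"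
    unfolding zx by (simp add: power2_norm_eq_inner)
  finally show ?thesis
    using \<open>L > 0\<close> by (simp add: G_def field_simps)
qed

text \<open>Fermat's rule: the derivative of the sum vanishes at a global minimum, so the sum of the
  gradients is orthogonal to every vector. In the algorithm this says that the optimal shifts add up
  to zero.\<close>

lemma sum_grad_eq_0_at_minimum:
  fixes f :: "'i \<Rightarrow> 'a::euclidean_space \<Rightarrow> real"
  assumes "\<And>i. i \<in> I \<Longrightarrow> f i differentiable (at x)"
    and "\<And>y. (\<Sum>i\<in>I. f i x) \<le> (\<Sum>i\<in>I. f i y)"
  shows "(\<Sum>i\<in>I. grad (f i) x) = 0"
proof -
  have "((\<lambda>y. \<Sum>i\<in>I. f i y) has_derivative (\<lambda>v. \<Sum>i\<in>I. inner v (grad (f i) x))) (at x)"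
    using GDERIV_grad[OF assms(1)] by (intro has_derivative_sum) (simp add: gderiv_def)
  then have "(\<lambda>v. \<Sum>i\<in>I. inner v (grad (f i) x)) = (\<lambda>v. 0)"
    using assms(2) by (intro differential_zero_maxmin[OF UNIV_I open_UNIV]) auto
  then have "inner v (\<Sum>i\<in>I. grad (f i) x) = 0" for v
    by (simp add: inner_sum_right fun_eq_iff)
  then show ?thesis
    using inner_eq_zero_iff by blast
qed

section \<open>Exact averaging over the synchronization coin\<close>

text \<open>After a synchronization, \<open>m\<close> plays the role of the common error of the
  iterates and \<open>m - u i\<close> that of the scaled error of the shifts. The cross terms cancel
  because the \<open>u i\<close> sum to \<open>card I\<close> times \<open>m\<close>.\<close>

lemma sum_norm2_mean_deviation:
  fixes u :: "'i \<Rightarrow> 'a::real_inner"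
  assumes "finite I" "I \<noteq> {}"
  defines "m \<equiv> (1 / real (card I)) *\<^sub>R (\<Sum>i\<in>I. u i)"
  shows "(\<Sum>i\<in>I. (norm m)\<^sup>2 + (norm (m - u i))\<^sup>2) = (\<Sum>i\<in>I. (norm (u i))\<^sup>2)"
proof -
  have sum: "(\<Sum>i\<in>I. u i) = real (card I) *\<^sub>R m"
    using assms(1,2) by (simp add: m_def)
  have "(\<Sum>i\<in>I. (norm m)\<^sup>2 + (norm (m - u i))\<^sup>2)
      = (\<Sum>i\<in>I. (norm (u i))\<^sup>2 + 2 * inner m m - 2 * inner m (u i))"
    by (intro sum.cong refl) (simp add: power2_norm_eq_inner algebra_simps inner_commute)
  also have "\<dots> = (\<Sum>i\<in>I. (norm (u i))\<^sup>2) + 2 * (real (card I) * inner m m) - 2 * inner m (\<Sum>i\<in>I. u i)"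
    by (simp add: sum.distrib sum_subtractf inner_sum_right sum_distrib_left)
  also have "\<dots> = (\<Sum>i\<in>I. (norm (u i))\<^sup>2)"
    by (simp add: sum)
  finally show ?thesis .
qed

text \<open>On both sides the cross term is \<open>-2 * \<gamma> * inner X D\<close>: the weight
  \<open>p\<close> cancels the division in \<open>\<gamma> / p\<close>. The total coefficient of
  \<open>(norm D)\<^sup>2\<close> is \<open>\<gamma>\<^sup>2 / p\<^sup>2\<close>; the right-hand
  side splits it as \<open>\<gamma>\<^sup>2\<close> plus the remainder, so that a full square with
  step \<open>\<gamma>\<close> appears.\<close>

lemma sync_average_norm2:
  fixes X D :: "'a::real_inner"
  assumes "p \<noteq> 0"
  shows "p * (norm (X - (\<gamma> / p) *\<^sub>R D))\<^sup>2
      + (1 - p) * ((norm X)\<^sup>2 + \<gamma>\<^sup>2 / p\<^sup>2 * (norm D)\<^sup>2)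
    = (norm (X - \<gamma> *\<^sub>R D))\<^sup>2 + \<gamma>\<^sup>2 / p\<^sup>2 * (1 - p\<^sup>2) * (norm D)\<^sup>2"
proof -
  have *: "(norm (X - c *\<^sub>R D))\<^sup>2 = inner X X - 2 * c * inner X D + c\<^sup>2 * inner D D" for c
    unfolding power2_norm_eq_inner by (simp add: algebra_simps inner_commute power2_eq_square)
  show ?thesis
    using assms unfolding * power2_norm_eq_inner[of X] power2_norm_eq_inner[of D]
    by (simp add: field_simps power2_eq_square)
qed

text \<open>With the local coins fixed, synchronizing yields the sum of the
  \<open>(norm (u i))\<^sup>2\<close> and skipping yields the unchanged errors \<open>X i\<close>
  and \<open>D i\<close>; these are the two outcomes weighted in
  \<open>sync_average_norm2\<close>.\<close>

lemma gradskip_step_average: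
  fixes f :: "nat \<Rightarrow> 'a::euclidean_space \<Rightarrow> real"
    and s :: "(nat \<Rightarrow> 'a) \<times> (nat \<Rightarrow> 'a)" and \<eta> :: "nat \<Rightarrow> bool"
  assumes "n \<ge> 1" "p > 0" "\<gamma> > 0" "(\<Sum>i\<in>{1..n}. grad (f i) x_star) = 0"
  defines "\<Phi> \<equiv> \<lambda>b. lyapunov n f \<gamma> p x_star (gradskip_step n f \<gamma> p b \<eta> s)"
  shows "p * \<Phi> True + (1 - p) * \<Phi> False
    = (\<Sum>i\<in>{1..n}.
        (norm (fst s i - x_star - \<gamma> *\<^sub>R (grad (f i) (fst s i) - grad (f i) x_star)))\<^sup>2
        + \<gamma>\<^sup>2 / p\<^sup>2 * (1 - p\<^sup>2) * (norm ((if \<eta> i then snd s i else grad (f i) (fst s i)) - grad (f i) x_star))\<^sup>2)"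
proof -
  define hhat where "hhat i = (if \<eta> i then snd s i else grad (f i) (fst s i))" for i
  have hhat_eq: "of_bool (\<eta> i) *\<^sub>R snd s i + (1 - of_bool (\<eta> i)) *\<^sub>R grad (f i) (fst s i) = hhat i" for i
    by (simp add: hhat_def)
  define xhat where "xhat i = fst s i - \<gamma> *\<^sub>R (grad (f i) (fst s i) - hhat i)" for i
  define D where "D i = hhat i - grad (f i) x_star" for i
  define X where "X i = xhat i - x_star" for i
  define u where "u i = X i - (\<gamma> / p) *\<^sub>R D i" for i
  define m where "m = (1 / real (card {1..n})) *\<^sub>R (\<Sum>i\<in>{1..n}. u i)"
  \<comment> \<open>The errors \<open>u j\<close> are measured from \<open>x_star\<close> and from
    the optimal shifts. As the latter sum to zero, the mean of the \<open>u j\<close> is the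
    synchronized iterate minus \<open>x_star\<close>.\<close>
  have "(\<Sum>j\<in>{1..n}. u j) = (\<Sum>j\<in>{1..n}. xhat j - (\<gamma> / p) *\<^sub>R hhat j) - real n *\<^sub>R x_star
      + (\<gamma> / p) *\<^sub>R (\<Sum>j\<in>{1..n}. grad (f j) x_star)"
    by (simp add: u_def X_def D_def sum.distrib sum_subtractf scaleR_right_diff_distrib
        scaleR_sum_right sum_constant_scaleR algebra_simps)
  then have "(\<Sum>j\<in>{1..n}. xhat j - (\<gamma> / p) *\<^sub>R hhat j) = (\<Sum>j\<in>{1..n}. u j) + real n *\<^sub>R x_star"
    unfolding assms(4) by simp
  then have m: "(1 / real n) *\<^sub>R (\<Sum>j\<in>{1..n}. xhat j - (\<gamma> / p) *\<^sub>R hhat j) = m + x_star"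
    using assms(1) by (simp add: m_def scaleR_add_right)
  have scaled: "\<gamma>\<^sup>2 / p\<^sup>2 * (norm v)\<^sup>2 = (norm ((\<gamma> / p) *\<^sub>R v))\<^sup>2" for v :: 'a
    by (simp add: power_mult_distrib power_divide)
  have dev: "(\<gamma> / p) *\<^sub>R (hhat i + (p / \<gamma>) *\<^sub>R (m + x_star - xhat i) - grad (f i) x_star) = m - u i" for i
    using assms(2,3) by (simp add: u_def X_def D_def algebra_simps)
  have "\<Phi> True = (\<Sum>i\<in>{1..n}. (norm m)\<^sup>2 + (norm (m - u i))\<^sup>2)"
    unfolding \<Phi>_def lyapunov_def gradskip_step_def Let_def hhat_eq xhat_def[symmetric]
      if_True fst_conv snd_conv m sum_distrib_left scaled dev sum.distrib by simp
  also have "\<dots> = (\<Sum>i\<in>{1..n}. (norm (u i))\<^sup>2)"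
    unfolding m_def by (rule sum_norm2_mean_deviation) (use assms(1) in auto)
  finally have sync: "\<Phi> True = (\<Sum>i\<in>{1..n}. (norm (u i))\<^sup>2)" .
  \<comment> \<open>Without synchronization the new iterate is \<open>xhat i\<close>, so the shift
    correction is zero and the shift stays \<open>hhat i\<close>.\<close>
  have skip: "\<Phi> False = (\<Sum>i\<in>{1..n}. (norm (X i))\<^sup>2 + \<gamma>\<^sup>2 / p\<^sup>2 * (norm (D i))\<^sup>2)"
    unfolding \<Phi>_def lyapunov_def gradskip_step_def Let_def hhat_eq
    by (simp add: sum_distrib_left xhat_def[symmetric] D_def X_def sum.distrib)
  have "p * \<Phi> True + (1 - p) * \<Phi> False
      = (\<Sum>i\<in>{1..n}. p * (norm (u i))\<^sup>2 + (1 - p) * ((norm (X i))\<^sup>2 + \<gamma>\<^sup>2 / p\<^sup>2 * (norm (D i))\<^sup>2))"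
    unfolding sync skip by (simp only: sum_distrib_left sum.distrib[symmetric])
  also have "\<dots> = (\<Sum>i\<in>{1..n}. (norm (X i - \<gamma> *\<^sub>R D i))\<^sup>2 + \<gamma>\<^sup>2 / p\<^sup>2 * (1 - p\<^sup>2) * (norm (D i))\<^sup>2)"
    unfolding u_def by (intro sum.cong refl sync_average_norm2) (use assms(2) in simp)
  also have "\<dots> = (\<Sum>i\<in>{1..n}.
        (norm (fst s i - x_star - \<gamma> *\<^sub>R (grad (f i) (fst s i) - grad (f i) x_star)))\<^sup>2
        + \<gamma>\<^sup>2 / p\<^sup>2 * (1 - p\<^sup>2) * (norm (hhat i - grad (f i) x_star))\<^sup>2)"
    \<comment> \<open>In \<open>X i - \<gamma> *\<^sub>R D i\<close> the terms with
      \<open>hhat i\<close> cancel, so the first square is independent of the local coin.\<close>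
    by (intro sum.cong refl) (simp add: X_def D_def xhat_def algebra_simps)
  finally show ?thesis
    unfolding hhat_def .
qed

section \<open>Deterministic contraction of the averaged Lyapunov function\<close>

text \<open>The symmetrized divergence is bounded below by cocoercivity in one direction and by
  strong convexity in the other. The squared gradient difference has total coefficient
  \<open>\<gamma>\<^sup>2 * c\<close>, which is at most \<open>\<gamma> / L\<close> and is thus
  absorbed by the cocoercivity term.\<close>

lemma gradient_step_contraction:
  fixes g :: "'a::euclidean_space \<Rightarrow> real"
  assumes "L > 0" "\<mu> \<ge> 0" "\<gamma> \<ge> 0" "\<gamma> * c \<le> 1 / L"
    and lower: "\<And>x y. \<mu> / 2 * (norm (x - y))\<^sup>2 \<le> bregman g x y"
    and upper: "\<And>x y. bregman g x y \<le> L / 2 * (norm (x - y))\<^sup>2"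
  shows "(norm (x - y - \<gamma> *\<^sub>R (grad g x - grad g y)))\<^sup>2 + \<gamma>\<^sup>2 * (c - 1) * (norm (grad g x - grad g y))\<^sup>2
    \<le> (1 - \<gamma> * \<mu>) * (norm (x - y))\<^sup>2"
proof -
  define a G where "a = x - y" and "G = grad g x - grad g y"
  have "0 \<le> bregman g u v" for u v
    using lower[of u v] \<open>\<mu> \<ge> 0\<close> by (smt (verit) divide_nonneg_nonneg mult_nonneg_nonneg zero_le_power2)
  then have "(norm G)\<^sup>2 / (2 * L) \<le> bregman g x y"
    unfolding G_def using bregman_ge_norm_grad_diff[OF \<open>L > 0\<close>] upper by blast
  moreover have "\<mu> / 2 * (norm a)\<^sup>2 \<le> bregman g y x"
    using lower[of y x] by (simp add: a_def norm_minus_commute)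
  ultimately have "(norm G)\<^sup>2 / L + \<mu> * (norm a)\<^sup>2 \<le> 2 * inner G a"
    using bregman_symmetrized[of g x y] by (simp add: a_def G_def)
  then have "\<gamma> * ((norm G)\<^sup>2 / L + \<mu> * (norm a)\<^sup>2) \<le> \<gamma> * (2 * inner G a)"
    using \<open>\<gamma> \<ge> 0\<close> by (rule mult_left_mono)
  moreover have "\<gamma> * (norm G)\<^sup>2 * (\<gamma> * c) \<le> \<gamma> * (norm G)\<^sup>2 * (1 / L)"
    using assms(3,4) by (intro mult_left_mono) auto
  moreover have "(norm (a - \<gamma> *\<^sub>R G))\<^sup>2 = (norm a)\<^sup>2 - 2 * \<gamma> * inner G a + \<gamma>\<^sup>2 * (norm G)\<^sup>2"
    unfolding power2_norm_eq_inner by (simp add: algebra_simps inner_commute power2_eq_square)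
  ultimately show ?thesis
    unfolding a_def[symmetric] G_def[symmetric] by (simp add: algebra_simps power2_eq_square)
qed

text \<open>This is the expected Lyapunov value after one step from the fixed state
  \<open>s\<close>, in closed form: a deterministic function that stands in for a conditional
  expectation.\<close>

definition averaged_lyapunov ::
  "nat \<Rightarrow> (nat \<Rightarrow> 'a::euclidean_space \<Rightarrow> real) \<Rightarrow> real \<Rightarrow> real \<Rightarrow> (nat \<Rightarrow> real) \<Rightarrow> 'a
    \<Rightarrow> (nat \<Rightarrow> 'a) \<times> (nat \<Rightarrow> 'a) \<Rightarrow> real" where
  "averaged_lyapunov n f \<gamma> p q x_star s = (\<Sum>i\<in>{1..n}.
     (norm (fst s i - x_star - \<gamma> *\<^sub>R (grad (f i) (fst s i) - grad (f i) x_star)))\<^sup>2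
     + \<gamma>\<^sup>2 / p\<^sup>2 * (1 - p\<^sup>2) * (q i * (norm (snd s i - grad (f i) x_star))\<^sup>2
       + (1 - q i) * (norm (grad (f i) (fst s i) - grad (f i) x_star))\<^sup>2))"

lemma averaged_lyapunov_le:
  fixes f :: "nat \<Rightarrow> 'a::euclidean_space \<Rightarrow> real"
    and s :: "(nat \<Rightarrow> 'a) \<times> (nat \<Rightarrow> 'a)"
  assumes "0 < p" "p \<le> 1" "\<gamma> > 0" "\<mu> \<ge> 0"
    and L: "\<And>i. i \<in> {1..n} \<Longrightarrow> L i > 0"
    and q: "\<And>i. i \<in> {1..n} \<Longrightarrow> q i \<le> 1"
    and step: "\<And>i. i \<in> {1..n} \<Longrightarrow> \<gamma> \<le> 1 / L i * (p\<^sup>2 / (1 - q i * (1 - p\<^sup>2)))"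
    and lower: "\<And>i x y. i \<in> {1..n} \<Longrightarrow> \<mu> / 2 * (norm (x - y))\<^sup>2 \<le> bregman (f i) x y"
    and upper: "\<And>i x y. i \<in> {1..n} \<Longrightarrow> bregman (f i) x y \<le> L i / 2 * (norm (x - y))\<^sup>2"
    and \<rho>: "\<rho> \<le> \<gamma> * \<mu>" "\<And>i. i \<in> {1..n} \<Longrightarrow> q i * (1 - p\<^sup>2) \<le> 1 - \<rho>"
  shows "averaged_lyapunov n f \<gamma> p q x_star s \<le> (1 - \<rho>) * lyapunov n f \<gamma> p x_star s"
  unfolding averaged_lyapunov_def lyapunov_def sum_distrib_left sum.distrib[symmetric]
proof (rule sum_mono)
  fix i assume i: "i \<in> {1..n}"
  define a G d where "a = fst s i - x_star" and "G = grad (f i) (fst s i) - grad (f i) x_star"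
    and "d = snd s i - grad (f i) x_star"
  define k where "k = \<gamma>\<^sup>2 / p\<^sup>2"
  \<comment> \<open>This \<open>c\<close> makes the stepsize condition read
    \<open>\<gamma> * c \<le> 1 / L i\<close>, while \<open>\<gamma>\<^sup>2 * (c - 1)\<close> is
    exactly the coefficient of the squared gradient difference in the averaged function.\<close>
  define c where "c = (1 - q i * (1 - p\<^sup>2)) / p\<^sup>2"
  have p2: "0 < p\<^sup>2" "p\<^sup>2 \<le> 1"
    using assms(1,2) by (auto simp: power_le_one)
  have "q i * (1 - p\<^sup>2) \<le> 1 * (1 - p\<^sup>2)"
    using q[OF i] p2 by (intro mult_right_mono) auto
  also have "\<dots> < 1"
    using p2 by simp
  finally have pos: "1 - q i * (1 - p\<^sup>2) > 0"
    by simp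
  have "\<gamma> * c \<le> 1 / L i * (p\<^sup>2 / (1 - q i * (1 - p\<^sup>2))) * c"
    using step[OF i] pos p2 by (intro mult_right_mono) (auto simp: c_def)
  also have "\<dots> = 1 / L i"
    using pos p2 by (simp add: c_def)
  finally have *: "(norm (a - \<gamma> *\<^sub>R G))\<^sup>2 + \<gamma>\<^sup>2 * (c - 1) * (norm G)\<^sup>2 \<le> (1 - \<gamma> * \<mu>) * (norm a)\<^sup>2"
    unfolding a_def G_def using assms(3,4) L[OF i] lower[OF i] upper[OF i]
    by (intro gradient_step_contraction[where L = "L i"]) auto
  have "\<gamma>\<^sup>2 * (c - 1) = k * (1 - p\<^sup>2) * (1 - q i)"
    using assms(1) by (simp add: c_def k_def field_simps)
  note *[unfolded this]
  moreover have "(1 - \<gamma> * \<mu>) * (norm a)\<^sup>2 \<le> (1 - \<rho>) * (norm a)\<^sup>2"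
    using \<rho>(1) by (intro mult_right_mono) auto
  moreover have "(q i * (1 - p\<^sup>2)) * (k * (norm d)\<^sup>2) \<le> (1 - \<rho>) * (k * (norm d)\<^sup>2)"
    using \<rho>(2)[OF i] by (intro mult_right_mono) (auto simp: k_def)
  ultimately show "(norm (fst s i - x_star - \<gamma> *\<^sub>R (grad (f i) (fst s i) - grad (f i) x_star)))\<^sup>2
        + \<gamma>\<^sup>2 / p\<^sup>2 * (1 - p\<^sup>2) * (q i * (norm (snd s i - grad (f i) x_star))\<^sup>2
          + (1 - q i) * (norm (grad (f i) (fst s i) - grad (f i) x_star))\<^sup>2)
      \<le> (1 - \<rho>) * ((norm (fst s i - x_star))\<^sup>2 + \<gamma>\<^sup>2 / p\<^sup>2 * (norm (snd s i - grad (f i) x_star))\<^sup>2)"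
    unfolding a_def[symmetric] G_def[symmetric] d_def[symmetric] k_def[symmetric] by (simp add: algebra_simps)
qed

section \<open>Dependence of the iterates on the coins\<close>

lemma gradskip_step_cong:
  fixes f :: "nat \<Rightarrow> 'a::euclidean_space \<Rightarrow> real"
  assumes "\<And>i. i \<in> {1..n} \<Longrightarrow> fst s i = fst s' i \<and> snd s i = snd s' i \<and> \<eta> i = \<eta>' i"
    and "i \<in> {1..n}"
  shows "fst (gradskip_step n f \<gamma> p b \<eta> s) i = fst (gradskip_step n f \<gamma> p b \<eta>' s') i"
    and "snd (gradskip_step n f \<gamma> p b \<eta> s) i = snd (gradskip_step n f \<gamma> p b \<eta>' s') i"
proof -
  have "(\<Sum>j\<in>{1..n}. F j (fst s j) (snd s j) (\<eta> j)) = (\<Sum>j\<in>{1..n}. F j (fst s' j) (snd s' j) (\<eta>' j))"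
    for F :: "nat \<Rightarrow> 'a \<Rightarrow> 'a \<Rightarrow> bool \<Rightarrow> 'a"
    using assms(1) by (intro sum.cong) auto
  \<comment> \<open>The instance is the summand of the synchronization average with
    \<open>hhat\<close> and \<open>xhat\<close> expanded.\<close>
  note sum = this[of "\<lambda>j x h e. x - \<gamma> *\<^sub>R (grad (f j) x - (of_bool e *\<^sub>R h + (1 - of_bool e) *\<^sub>R grad (f j) x))
      - (\<gamma> / p) *\<^sub>R (of_bool e *\<^sub>R h + (1 - of_bool e) *\<^sub>R grad (f j) x)"]
  have i: "fst s i = fst s' i" "snd s i = snd s' i" "\<eta> i = \<eta>' i"
    using assms(1)[OF assms(2)] by auto
  show "fst (gradskip_step n f \<gamma> p b \<eta> s) i = fst (gradskip_step n f \<gamma> p b \<eta>' s') i"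
    "snd (gradskip_step n f \<gamma> p b \<eta> s) i = snd (gradskip_step n f \<gamma> p b \<eta>' s') i"
    unfolding gradskip_step_def Let_def fst_conv snd_conv sum i by (rule refl)+
qed

text \<open>The state at time \<open>t\<close> is built from coins of strictly earlier times, which
  is what later makes it independent of the coins of time \<open>t\<close>.\<close>

lemma gradskip_cong:
  assumes "\<And>r. r < t \<Longrightarrow> \<theta> r \<omega> = \<theta> r \<omega>'"
    and "\<And>r i. r < t \<Longrightarrow> i \<in> {1..n} \<Longrightarrow> \<eta> i r \<omega> = \<eta> i r \<omega>'"
    and "i \<in> {1..n}"
  shows "fst (gradskip n f \<gamma> p x0 h0 \<theta> \<eta> t \<omega>) i = fst (gradskip n f \<gamma> p x0 h0 \<theta> \<eta> t \<omega>') i"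
    and "snd (gradskip n f \<gamma> p x0 h0 \<theta> \<eta> t \<omega>) i = snd (gradskip n f \<gamma> p x0 h0 \<theta> \<eta> t \<omega>') i"
proof -
  have "\<forall>i\<in>{1..n}. fst (gradskip n f \<gamma> p x0 h0 \<theta> \<eta> t \<omega>) i = fst (gradskip n f \<gamma> p x0 h0 \<theta> \<eta> t \<omega>') i
      \<and> snd (gradskip n f \<gamma> p x0 h0 \<theta> \<eta> t \<omega>) i = snd (gradskip n f \<gamma> p x0 h0 \<theta> \<eta> t \<omega>') i"
    using assms(1,2)
  proof (induction t)
    case 0
    show ?case by simp
  next
    case (Suc t)
    have \<theta>: "\<theta> t \<omega> = \<theta> t \<omega>'"
      using Suc.prems(1) by simp
    have agree: "fst (gradskip n f \<gamma> p x0 h0 \<theta> \<eta> t \<omega>) i = fst (gradskip n f \<gamma> p x0 h0 \<theta> \<eta> t \<omega>') i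
      \<and> snd (gradskip n f \<gamma> p x0 h0 \<theta> \<eta> t \<omega>) i = snd (gradskip n f \<gamma> p x0 h0 \<theta> \<eta> t \<omega>') i
      \<and> \<eta> i t \<omega> = \<eta> i t \<omega>'" if "i \<in> {1..n}" for i
      using Suc.IH Suc.prems that by (meson lessI less_SucI)
    show ?case
      unfolding gradskip.simps \<theta>
      by (intro ballI conjI; rule gradskip_step_cong[OF agree]; assumption)
  qed
  then show "fst (gradskip n f \<gamma> p x0 h0 \<theta> \<eta> t \<omega>) i = fst (gradskip n f \<gamma> p x0 h0 \<theta> \<eta> t \<omega>') i"
    "snd (gradskip n f \<gamma> p x0 h0 \<theta> \<eta> t \<omega>) i = snd (gradskip n f \<gamma> p x0 h0 \<theta> \<eta> t \<omega>') i"
    using assms(3) by blast+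
qed

lemma lyapunov_cong:
  assumes "\<And>i. i \<in> {1..n} \<Longrightarrow> fst s i = fst s' i"
    and "\<And>i. i \<in> {1..n} \<Longrightarrow> snd s i = snd s' i"
  shows "lyapunov n f \<gamma> p x_star s = lyapunov n f \<gamma> p x_star s'"
  unfolding lyapunov_def using assms
  by (intro arg_cong2[where f = "(+)"] arg_cong2[where f = "(*)"] sum.cong refl) auto

text \<open>
  Local coins with index outside \<open>{1..n}\<close> need not be measurable, so whole states need not be
  random variables. Quantities that depend on finitely many genuine coins, however, are
  measurable with finite range.
\<close>
definition depends_on :: "('c \<Rightarrow> 'w \<Rightarrow> 'v) \<Rightarrow> 'c set \<Rightarrow> ('w \<Rightarrow> 'b) \<Rightarrow> bool" where
  "depends_on X J Y \<longleftrightarrow> (\<forall>\<omega> \<omega>'. (\<forall>j\<in>J. X j \<omega> = X j \<omega>') \<longrightarrow> Y \<omega> = Y \<omega>')"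

text \<open>\<open>Z\<close> evaluates \<open>Y\<close> at an arbitrary outcome that shows the given
  coin pattern; dependence on \<open>J\<close> alone makes the choice immaterial. An explicit factor
  is what the composition rules for measurability and independence require.\<close>

lemma depends_on_factor:
  assumes "depends_on X J Y"
  obtains Z where "Y = (\<lambda>\<omega>. Z (\<lambda>j\<in>J. X j \<omega>))"
proof
  show "Y = (\<lambda>\<omega>. (\<lambda>r. Y (SOME \<omega>'. (\<lambda>j\<in>J. X j \<omega>') = r)) (\<lambda>j\<in>J. X j \<omega>))"
  proof
    fix \<omega>
    let ?\<omega>' = "SOME \<omega>'. (\<lambda>j\<in>J. X j \<omega>') = (\<lambda>j\<in>J. X j \<omega>)"
    have "(\<lambda>j\<in>J. X j ?\<omega>') = (\<lambda>j\<in>J. X j \<omega>)"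
      by (rule someI) (rule refl)
    then have "X j ?\<omega>' = X j \<omega>" if "j \<in> J" for j
      using that by (auto dest: fun_cong[where x = j])
    then have "Y ?\<omega>' = Y \<omega>"
      using assms unfolding depends_on_def by blast
    then show "Y \<omega> = (\<lambda>r. Y (SOME \<omega>'. (\<lambda>j\<in>J. X j \<omega>') = r)) (\<lambda>j\<in>J. X j \<omega>)"
      by (rule sym)
  qed
qed

section \<open>Expectation of one iteration\<close>

context prob_space
begin

text \<open>Finitely many Boolean coins have finitely many patterns. The pattern space is discrete,
  so every function on it is measurable, and \<open>Y\<close> has finite range, hence is
  bounded.\<close>

lemma integrable_depends_on_coins:
  fixes X :: "'c \<Rightarrow> 'a \<Rightarrow> bool" and Y :: "'a \<Rightarrow> real"
  assumes X: "\<And>j. j \<in> J \<Longrightarrow> X j \<in> measurable M (count_space UNIV)"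
    and "finite J" "depends_on X J Y"
  shows "integrable M Y"
proof -
  obtain Z where Z: "Y = (\<lambda>\<omega>. Z (\<lambda>j\<in>J. X j \<omega>))"
    using assms(3) by (rule depends_on_factor)
  have "(\<lambda>\<omega>. \<lambda>j\<in>J. X j \<omega>) \<in> measurable M (PiM J (\<lambda>_. count_space UNIV))"
    using X by (intro measurable_restrict) auto
  then have "(\<lambda>\<omega>. \<lambda>j\<in>J. X j \<omega>) \<in> measurable M (count_space (J \<rightarrow>\<^sub>E UNIV))"
    using \<open>finite J\<close> by (subst (asm) count_space_PiM_finite) auto
  moreover have "Z \<in> borel_measurable (count_space (J \<rightarrow>\<^sub>E UNIV))"
    by simp
  ultimately have meas: "Y \<in> borel_measurable M"
    unfolding Z by (rule measurable_compose)
  have "finite (Z ` (J \<rightarrow>\<^sub>E UNIV))"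
    using \<open>finite J\<close> by (intro finite_imageI finite_PiE) auto
  moreover have "range Y \<subseteq> Z ` (J \<rightarrow>\<^sub>E UNIV)"
    unfolding Z by auto
  ultimately have "finite (range Y)"
    by (rule rev_finite_subset)
  then have "finite (norm ` range Y)"
    by (rule finite_imageI)
  then have "AE \<omega> in M. norm (Y \<omega>) \<le> Max (norm ` range Y)"
    by (intro AE_I2 Max_ge) auto
  then show ?thesis
    using meas by (rule integrable_const_bound)
qed

text \<open>The coin \<open>c\<close> lies outside \<open>J\<close>, so it is independent of every
  function of the coins in \<open>J\<close>, and the expectation of the product factors.\<close>

lemma expectation_coin_mult:
  fixes X :: "'c \<Rightarrow> 'a \<Rightarrow> bool" and Y :: "'a \<Rightarrow> real"
  assumes indep: "indep_vars (\<lambda>_. count_space UNIV) X I"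
    and "finite J" "J \<subseteq> I" "c \<in> I - J" and dep: "depends_on X J Y"
  shows "integrable M (\<lambda>\<omega>. of_bool (X c \<omega>) * Y \<omega>)"
    and "expectation (\<lambda>\<omega>. of_bool (X c \<omega>) * Y \<omega>) = prob {\<omega> \<in> space M. X c \<omega>} * expectation Y"
proof -
  have meas: "X j \<in> measurable M (count_space UNIV)" if "j \<in> I" for j
    using indep that unfolding indep_vars_def by auto
  obtain Z where Z: "Y = (\<lambda>\<omega>. Z (\<lambda>j\<in>J. X j \<omega>))"
    using dep by (rule depends_on_factor)
  have "indep_var (PiM {c} (\<lambda>_. count_space UNIV)) (\<lambda>\<omega>. \<lambda>j\<in>{c}. X j \<omega>)
      (PiM J (\<lambda>_. count_space UNIV)) (\<lambda>\<omega>. \<lambda>j\<in>J. X j \<omega>)"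
    using assms by (intro indep_var_restrict[OF indep]) auto
  then have "indep_var borel ((\<lambda>r. of_bool (r c)) \<circ> (\<lambda>\<omega>. \<lambda>j\<in>{c}. X j \<omega>))
      borel (Z \<circ> (\<lambda>\<omega>. \<lambda>j\<in>J. X j \<omega>))"
    by (rule indep_var_compose) (use \<open>finite J\<close> in \<open>auto simp: count_space_PiM_finite\<close>)
  then have indep': "indep_var borel (\<lambda>\<omega>. of_bool (X c \<omega>)) borel Y"
    by (simp add: Z comp_def)
  have intc: "integrable M (\<lambda>\<omega>. of_bool (X c \<omega>) :: real)"
    by (rule integrable_depends_on_coins[of "{c}" X])
      (use assms meas in \<open>auto simp: depends_on_def\<close>)
  have intY: "integrable M Y"
    by (rule integrable_depends_on_coins[of J X]) (use assms meas in auto)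
  show "integrable M (\<lambda>\<omega>. of_bool (X c \<omega>) * Y \<omega>)"
    using indep' intc intY by (rule indep_var_integrable)
  have "expectation (\<lambda>\<omega>. of_bool (X c \<omega>)) = prob {\<omega> \<in> space M. X c \<omega>}"
  proof -
    have "expectation (\<lambda>\<omega>. of_bool (X c \<omega>)) = expectation (indicator {\<omega> \<in> space M. X c \<omega>} :: 'a \<Rightarrow> real)"
      by (intro Bochner_Integration.integral_cong) (auto simp: indicator_def)
    also have "\<dots> = prob {\<omega> \<in> space M. X c \<omega>}"
      by (subst Bochner_Integration.integral_indicator) (auto intro!: arg_cong[where f = prob])
    finally show ?thesis .
  qed
  then show "expectation (\<lambda>\<omega>. of_bool (X c \<omega>) * Y \<omega>) = prob {\<omega> \<in> space M. X c \<omega>} * expectation Y"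
    using indep_var_lebesgue_integral[OF indep' intc intY] by simp
qed

text \<open>The coins of time \<open>t\<close> are averaged out in two layers: first the
  synchronization coin against everything else, then each local coin against the past.\<close>

lemma expectation_lyapunov_gradskip_Suc:
  fixes f :: "nat \<Rightarrow> 'e::euclidean_space \<Rightarrow> real" and x_star x0 :: 'e and h0 :: "nat \<Rightarrow> 'e"
  assumes coins: "gradskip_coins M n p q \<theta> \<eta>"
    and n: "n \<ge> 1" and p: "p > 0" and \<gamma>: "\<gamma> > 0"
    and stationary: "(\<Sum>i\<in>{1..n}. grad (f i) x_star) = 0"
  defines "S \<equiv> gradskip n f \<gamma> p x0 h0 \<theta> \<eta>"
  shows "integrable M (\<lambda>\<omega>. lyapunov n f \<gamma> p x_star (S t \<omega>))"
    and "integrable M (\<lambda>\<omega>. averaged_lyapunov n f \<gamma> p q x_star (S t \<omega>))"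
    and "expectation (\<lambda>\<omega>. lyapunov n f \<gamma> p x_star (S (Suc t) \<omega>))
      = expectation (\<lambda>\<omega>. averaged_lyapunov n f \<gamma> p q x_star (S t \<omega>))"
proof -
  define X where "X = (\<lambda>c. case c of Sync t \<Rightarrow> \<theta> t | Local i t \<Rightarrow> \<eta> i t)"
  define I where "I = range Sync \<union> {Local i t | i t. i \<in> {1..n}}"
  \<comment> \<open>\<open>J\<close> holds the coins that determine the state at time
    \<open>t\<close>. \<open>J'\<close> adds the local coins of time \<open>t\<close>, so that only
    \<open>Sync t\<close> is missing for the next state.\<close>
  define J where "J = Sync ` {..<t} \<union> (\<lambda>(i, r). Local i r) ` ({1..n} \<times> {..<t})"
  define J' where "J' = J \<union> (\<lambda>i. Local i t) ` {1..n}"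
  have X_simps [simp]: "X (Sync r) = \<theta> r" "X (Local i r) = \<eta> i r" for i r
    by (simp_all add: X_def)
  have indep: "indep_vars (\<lambda>_. count_space UNIV) X I"
    and prob_\<theta>: "prob {\<omega> \<in> space M. \<theta> t \<omega>} = p"
    and prob_\<eta>: "\<And>i. i \<in> {1..n} \<Longrightarrow> prob {\<omega> \<in> space M. \<eta> i t \<omega>} = q i"
    using coins unfolding gradskip_coins_def X_def I_def by auto
  have fin: "finite J" "finite J'"
    by (simp_all add: J_def J'_def)
  have sub: "J \<subseteq> I" "J' \<subseteq> I"
    by (auto simp: J_def J'_def I_def)
  have sync: "Sync t \<in> I - J'" and local: "\<And>i. i \<in> {1..n} \<Longrightarrow> Local i t \<in> I - J"
    by (auto simp: J_def J'_def I_def)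
  have meas: "X j \<in> measurable M (count_space UNIV)" if "j \<in> I" for j
    using indep that unfolding indep_vars_def by auto
  have int: "integrable M Y" if "depends_on X J Y" for Y :: "'a \<Rightarrow> real"
    by (rule integrable_depends_on_coins[OF _ fin(1) that]) (use meas sub in auto)
  have int': "integrable M Y" if "depends_on X J' Y" for Y :: "'a \<Rightarrow> real"
    by (rule integrable_depends_on_coins[OF _ fin(2) that]) (use meas sub in auto)
  have S_cong: "fst (S t \<omega>) i = fst (S t \<omega>') i" "snd (S t \<omega>) i = snd (S t \<omega>') i"
    if "\<forall>j\<in>J. X j \<omega> = X j \<omega>'" "i \<in> {1..n}" for \<omega> \<omega>' i
  proof -
    have \<theta>: "\<theta> r \<omega> = \<theta> r \<omega>'" if "r < t" for r
    proof -
      have "Sync r \<in> J"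
        using that by (simp add: J_def)
      with \<open>\<forall>j\<in>J. X j \<omega> = X j \<omega>'\<close> have "X (Sync r) \<omega> = X (Sync r) \<omega>'" ..
      then show ?thesis
        by simp
    qed
    have \<eta>: "\<eta> k r \<omega> = \<eta> k r \<omega>'" if "r < t" "k \<in> {1..n}" for k r
    proof -
      have "Local k r \<in> J"
        using that by (force simp: J_def)
      with \<open>\<forall>j\<in>J. X j \<omega> = X j \<omega>'\<close> have "X (Local k r) \<omega> = X (Local k r) \<omega>'" ..
      then show ?thesis
        by simp
    qed
    show "fst (S t \<omega>) i = fst (S t \<omega>') i" "snd (S t \<omega>) i = snd (S t \<omega>') i"
      unfolding S_def by (intro gradskip_cong \<theta> \<eta> that(2); assumption)+
  qed

  define \<Phi> where "\<Phi> b \<omega> = lyapunov n f \<gamma> p x_star (gradskip_step n f \<gamma> p b (\<lambda>i. \<eta> i t \<omega>) (S t \<omega>))" for b \<omega>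
  define W where "W i \<omega> = (norm (fst (S t \<omega>) i - x_star
      - \<gamma> *\<^sub>R (grad (f i) (fst (S t \<omega>) i) - grad (f i) x_star)))\<^sup>2" for i \<omega>
  define D where "D i \<omega> = (norm (snd (S t \<omega>) i - grad (f i) x_star))\<^sup>2" for i \<omega>
  define G where "G i \<omega> = (norm (grad (f i) (fst (S t \<omega>) i) - grad (f i) x_star))\<^sup>2" for i \<omega>
  define K where "K = \<gamma>\<^sup>2 / p\<^sup>2 * (1 - p\<^sup>2)"
  have dep_\<Phi>: "depends_on X J' (\<Phi> b)" for b
    unfolding depends_on_def \<Phi>_def
  proof (intro allI impI)
    fix \<omega> \<omega>' assume agree: "\<forall>j\<in>J'. X j \<omega> = X j \<omega>'"
    have "fst (S t \<omega>) i = fst (S t \<omega>') i \<and> snd (S t \<omega>) i = snd (S t \<omega>') i \<and> \<eta> i t \<omega> = \<eta> i t \<omega>'"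
      if "i \<in> {1..n}" for i
    proof -
      have "\<forall>j\<in>J. X j \<omega> = X j \<omega>'" "X (Local i t) \<omega> = X (Local i t) \<omega>'"
        using agree that by (auto simp only: J'_def)
      then show ?thesis
        using S_cong that by simp
    qed
    note step = gradskip_step_cong[OF this]
    show "lyapunov n f \<gamma> p x_star (gradskip_step n f \<gamma> p b (\<lambda>i. \<eta> i t \<omega>) (S t \<omega>))
        = lyapunov n f \<gamma> p x_star (gradskip_step n f \<gamma> p b (\<lambda>i. \<eta> i t \<omega>') (S t \<omega>'))"
      by (rule lyapunov_cong; rule step; assumption)
  qed
  have dep_state: "depends_on X J (\<lambda>\<omega>. F (fst (S t \<omega>) i) (snd (S t \<omega>) i))"
    if "i \<in> {1..n}" for i and F :: "'e \<Rightarrow> 'e \<Rightarrow> real"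
    unfolding depends_on_def by (intro allI impI arg_cong2[where f = F] S_cong that)
  have dep: "depends_on X J (W i)" "depends_on X J (D i)" "depends_on X J (G i)"
    if "i \<in> {1..n}" for i
    using dep_state[OF that, of "\<lambda>x h. (norm (x - x_star - \<gamma> *\<^sub>R (grad (f i) x - grad (f i) x_star)))\<^sup>2"]
      dep_state[OF that, of "\<lambda>x h. (norm (h - grad (f i) x_star))\<^sup>2"]
      dep_state[OF that, of "\<lambda>x h. (norm (grad (f i) x - grad (f i) x_star))\<^sup>2"]
    by (simp_all only: W_def[abs_def] D_def[abs_def] G_def[abs_def])
  have intWDG: "integrable M (W i)" "integrable M (D i)" "integrable M (G i)" if "i \<in> {1..n}" for i
    using dep[OF that] by (auto intro: int)
  show "integrable M (\<lambda>\<omega>. lyapunov n f \<gamma> p x_star (S t \<omega>))"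
    by (rule int) (auto simp: depends_on_def intro!: lyapunov_cong S_cong)
  have "integrable M (\<lambda>\<omega>. \<Sum>i\<in>{1..n}. W i \<omega> + K * (q i * D i \<omega> + (1 - q i) * G i \<omega>))"
    using intWDG by (intro Bochner_Integration.integrable_sum Bochner_Integration.integrable_add
        integrable_mult_right) auto
  then show "integrable M (\<lambda>\<omega>. averaged_lyapunov n f \<gamma> p q x_star (S t \<omega>))"
    by (simp only: averaged_lyapunov_def W_def D_def G_def K_def)

  have int\<Phi>: "integrable M (\<Phi> b)" for b
    using dep_\<Phi> by (rule int')
  have dep_diff: "depends_on X J' (\<lambda>\<omega>. \<Phi> True \<omega> - \<Phi> False \<omega>)"
    using dep_\<Phi> unfolding depends_on_def by metis
  have int_sync: "integrable M (\<lambda>\<omega>. of_bool (\<theta> t \<omega>) * (\<Phi> True \<omega> - \<Phi> False \<omega>))"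
    using expectation_coin_mult(1)[OF indep fin(2) sub(2) sync dep_diff] by simp
  \<comment> \<open>The case distinction on the coin is written as an affine function of its
    indicator, the form to which \<open>expectation_coin_mult\<close> applies.\<close>
  have "expectation (\<lambda>\<omega>. lyapunov n f \<gamma> p x_star (S (Suc t) \<omega>))
      = expectation (\<lambda>\<omega>. \<Phi> False \<omega> + of_bool (\<theta> t \<omega>) * (\<Phi> True \<omega> - \<Phi> False \<omega>))"
    by (intro Bochner_Integration.integral_cong refl) (auto simp: S_def \<Phi>_def)
  also have "\<dots> = expectation (\<Phi> False) + p * expectation (\<lambda>\<omega>. \<Phi> True \<omega> - \<Phi> False \<omega>)"
    using expectation_coin_mult(2)[OF indep fin(2) sub(2) sync dep_diff] prob_\<theta> int\<Phi> int_sync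
    by simp
  also have "\<dots> = expectation (\<lambda>\<omega>. p * \<Phi> True \<omega> + (1 - p) * \<Phi> False \<omega>)"
    using int\<Phi> by (simp add: algebra_simps)
  \<comment> \<open>The same device for the local coins. Each summand contains only its own coin, so
    pairing \<open>\<eta> i t\<close> with the past \<open>J\<close> suffices.\<close>
  also have "\<dots> = expectation (\<lambda>\<omega>. \<Sum>i\<in>{1..n}. W i \<omega> + K * G i \<omega>
      + K * (of_bool (\<eta> i t \<omega>) * (D i \<omega> - G i \<omega>)))"
    unfolding \<Phi>_def gradskip_step_average[OF n p \<gamma> stationary]
    by (intro Bochner_Integration.integral_cong refl sum.cong)
      (auto simp: W_def D_def G_def K_def algebra_simps)
  also have "\<dots> = (\<Sum>i\<in>{1..n}. expectation (W i) + K * expectation (G i)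
      + K * (q i * (expectation (D i) - expectation (G i))))"
  proof -
    have "integrable M (\<lambda>\<omega>. of_bool (\<eta> i t \<omega>) * (D i \<omega> - G i \<omega>))"
      and "expectation (\<lambda>\<omega>. of_bool (\<eta> i t \<omega>) * (D i \<omega> - G i \<omega>)) = q i * (expectation (D i) - expectation (G i))"
      if i: "i \<in> {1..n}" for i
    proof -
      have dep_diff: "depends_on X J (\<lambda>\<omega>. D i \<omega> - G i \<omega>)"
        using dep[OF i] unfolding depends_on_def by metis
      show "integrable M (\<lambda>\<omega>. of_bool (\<eta> i t \<omega>) * (D i \<omega> - G i \<omega>))"
        using expectation_coin_mult(1)[OF indep fin(1) sub(1) local[OF i] dep_diff] by simp
      show "expectation (\<lambda>\<omega>. of_bool (\<eta> i t \<omega>) * (D i \<omega> - G i \<omega>)) = q i * (expectation (D i) - expectation (G i))"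
        using expectation_coin_mult(2)[OF indep fin(1) sub(1) local[OF i] dep_diff] prob_\<eta>[OF i] intWDG[OF i]
        by simp
    qed
    then show ?thesis
      using intWDG by (subst Bochner_Integration.integral_sum) auto
  qed
  also have "\<dots> = expectation (\<lambda>\<omega>. \<Sum>i\<in>{1..n}. W i \<omega> + K * (q i * D i \<omega> + (1 - q i) * G i \<omega>))"
    using intWDG by (subst Bochner_Integration.integral_sum) (auto simp: algebra_simps intro!: sum.cong)
  finally show "expectation (\<lambda>\<omega>. lyapunov n f \<gamma> p x_star (S (Suc t) \<omega>))
      = expectation (\<lambda>\<omega>. averaged_lyapunov n f \<gamma> p q x_star (S t \<omega>))"
    by (simp only: averaged_lyapunov_def W_def D_def G_def K_def)
qed

end

section \<open>Iterating the one-step contraction\<close>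

theorem theorem3p5:
  fixes M :: "'w measure"
    and n :: nat
    and f :: "nat \<Rightarrow> real ^ 'd \<Rightarrow> real"
    and \<mu> \<gamma> p :: real
    and L q :: "nat \<Rightarrow> real"
    and x_star x0 :: "real ^ 'd"
    and h0 :: "nat \<Rightarrow> real ^ 'd"
    and \<theta> :: "nat \<Rightarrow> 'w \<Rightarrow> bool"
    and \<eta> :: "nat \<Rightarrow> nat \<Rightarrow> 'w \<Rightarrow> bool"
  defines "\<rho> \<equiv> min (\<gamma> * \<mu>) (1 - (MAX i\<in>{1..n}. q i) * (1 - p\<^sup>2))"
    and "\<Psi> \<equiv> (\<lambda>t \<omega>. lyapunov n f \<gamma> p x_star (gradskip n f \<gamma> p x0 h0 \<theta> \<eta> t \<omega>))"
    and "\<Psi>0 \<equiv> lyapunov n f \<gamma> p x_star ((\<lambda>i. x0), h0)"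
  assumes "prob_space M"
    and "n \<ge> 1"
    and "\<And>i x. i \<in> {1..n} \<Longrightarrow> f i differentiable (at x)"
    and "\<mu> > 0"
    and "\<And>i. i \<in> {1..n} \<Longrightarrow> L i > 0"
    and "\<And>i x y. i \<in> {1..n} \<Longrightarrow>
           \<mu> / 2 * (norm (x - y))\<^sup>2 \<le> bregman (f i) x y \<and>
           bregman (f i) x y \<le> L i / 2 * (norm (x - y))\<^sup>2"
    and "\<And>y. y \<noteq> x_star \<Longrightarrow>
           (1 / real n) * (\<Sum>i\<in>{1..n}. f i x_star) < (1 / real n) * (\<Sum>i\<in>{1..n}. f i y)"
    and "0 < p" and "p \<le> 1"
    and "\<And>i. i \<in> {1..n} \<Longrightarrow> 0 < q i \<and> q i \<le> 1"
    and "\<gamma> > 0"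
    and "\<gamma> \<le> (MIN i\<in>{1..n}. 1 / L i * (p\<^sup>2 / (1 - q i * (1 - p\<^sup>2))))"
    and "gradskip_coins M n p q \<theta> \<eta>"
  shows "\<rho> > 0 \<and>
    (\<forall>t\<ge>1. integrable M (\<Psi> t) \<and> prob_space.expectation M (\<Psi> t) \<le> (1 - \<rho>) ^ t * \<Psi>0)"
proof -
  interpret prob_space M by fact
  note n = \<open>n \<ge> 1\<close> and bregman = assms(9) and min = assms(10) and q = assms(13)
  have p2: "0 < p\<^sup>2" "p\<^sup>2 \<le> 1"
    using \<open>0 < p\<close> \<open>p \<le> 1\<close> by (auto simp: power_le_one)
  have q_max: "(MAX i\<in>{1..n}. q i) \<le> 1" "\<And>i. i \<in> {1..n} \<Longrightarrow> q i \<le> (MAX i\<in>{1..n}. q i)"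
    using n q by auto
  have "(MAX i\<in>{1..n}. q i) * (1 - p\<^sup>2) \<le> 1 * (1 - p\<^sup>2)"
    using q_max(1) p2 by (intro mult_right_mono) auto
  also have "\<dots> < 1"
    using p2 by simp
  finally have \<rho>_pos: "\<rho> > 0"
    using \<open>\<gamma> > 0\<close> \<open>\<mu> > 0\<close> by (simp add: \<rho>_def)
  have \<rho>_le: "q i * (1 - p\<^sup>2) \<le> 1 - \<rho>" if "i \<in> {1..n}" for i
  proof -
    have "q i * (1 - p\<^sup>2) \<le> (MAX i\<in>{1..n}. q i) * (1 - p\<^sup>2)"
      using q_max(2)[OF that] p2 by (intro mult_right_mono) auto
    then show ?thesis
      by (simp add: \<rho>_def)
  qed
  \<comment> \<open>Client 1 exists because \<open>n \<ge> 1\<close>. Its bound gives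
    \<open>0 \<le> 1 - \<rho>\<close>, so the induction hypothesis can be multiplied by this
    factor.\<close>
  have "0 \<le> q 1 * (1 - p\<^sup>2)"
    using q[of 1] n p2 by simp
  then have \<rho>_le_1: "0 \<le> 1 - \<rho>"
    using \<rho>_le[of 1] n by simp
  have \<rho>_\<mu>: "\<rho> \<le> \<gamma> * \<mu>"
    by (simp add: \<rho>_def)
  have step: "\<gamma> \<le> 1 / L i * (p\<^sup>2 / (1 - q i * (1 - p\<^sup>2)))" if "i \<in> {1..n}" for i
  proof -
    have "(MIN i\<in>{1..n}. 1 / L i * (p\<^sup>2 / (1 - q i * (1 - p\<^sup>2)))) \<le> 1 / L i * (p\<^sup>2 / (1 - q i * (1 - p\<^sup>2)))"
      using that by (intro Min_le) auto
    with assms(15) show ?thesis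
      by (rule order_trans)
  qed
  have stationary: "(\<Sum>i\<in>{1..n}. grad (f i) x_star) = 0"
  proof (rule sum_grad_eq_0_at_minimum)
    show "f i differentiable (at x_star)" if "i \<in> {1..n}" for i
      using that by fact
    show "(\<Sum>i\<in>{1..n}. f i x_star) \<le> (\<Sum>i\<in>{1..n}. f i y)" for y
      using min[of y] n by (cases "y = x_star") (auto simp: field_simps)
  qed
  note Suc_step = expectation_lyapunov_gradskip_Suc[OF assms(16) n \<open>0 < p\<close> \<open>\<gamma> > 0\<close> stationary,
      where ?x0.0 = x0 and ?h0.0 = h0]
  have int: "integrable M (\<Psi> t)" for t
    unfolding \<Psi>_def by (rule Suc_step)
  have contraction: "expectation (\<Psi> (Suc t)) \<le> (1 - \<rho>) * expectation (\<Psi> t)" for t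
  proof -
    \<comment> \<open>The contraction holds for every state, hence pointwise in
      \<open>\<omega>\<close>, and monotonicity of the integral carries it over to
      expectations.\<close>
    have "expectation (\<Psi> (Suc t)) \<le> expectation (\<lambda>\<omega>. (1 - \<rho>) * \<Psi> t \<omega>)"
      unfolding \<Psi>_def Suc_step(3)
    proof (rule integral_mono[OF Suc_step(2)])
      show "integrable M (\<lambda>\<omega>. (1 - \<rho>) * lyapunov n f \<gamma> p x_star (gradskip n f \<gamma> p x0 h0 \<theta> \<eta> t \<omega>))"
        by (rule integrable_mult_right[OF Suc_step(1)])
    next
      fix \<omega>
      show "averaged_lyapunov n f \<gamma> p q x_star (gradskip n f \<gamma> p x0 h0 \<theta> \<eta> t \<omega>)
        \<le> (1 - \<rho>) * lyapunov n f \<gamma> p x_star (gradskip n f \<gamma> p x0 h0 \<theta> \<eta> t \<omega>)"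
        using \<open>0 < p\<close> \<open>p \<le> 1\<close> \<open>\<gamma> > 0\<close> \<open>\<mu> > 0\<close> assms(8) q bregman step \<rho>_\<mu> \<rho>_le
        by (intro averaged_lyapunov_le[where L = L and \<mu> = \<mu>]) auto
    qed
    then show ?thesis
      using int by simp
  qed
  have "expectation (\<Psi> t) \<le> (1 - \<rho>) ^ t * \<Psi>0" for t
  proof (induction t)
    case 0
    show ?case
      by (simp add: \<Psi>_def \<Psi>0_def prob_space)
  next
    case (Suc t)
    have "(1 - \<rho>) * expectation (\<Psi> t) \<le> (1 - \<rho>) * ((1 - \<rho>) ^ t * \<Psi>0)"
      using Suc.IH \<rho>_le_1 by (rule mult_left_mono)
    with contraction[of t] show ?case
      by simp
  qed
  with \<rho>_pos int show ?thesis
    by blast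
qed

end
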